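(* For $\lambda\ge 0$ consider the boundary value problem $$r^2w''(r)-rw'(r)=\frac{\lambda}{2}r^4+\frac{w^2(r)}{2}\quad\text{for } r\in(0,1],\qquad \lim_{r\to 0_+}w'(r)=0,\qquad w(1)=0. \qquad (D_\lambda)$$ Let $\lambda_0>0$ be the real number such that $(D_\lambda)$ is solvable for every $\lambda\in[0,\lambda_0)$ and has no solution for $\lambda>\lambda_0$ (such a number exists). Then $$144\le\lambda_0\le 307.$$
   Context: A solution is a real-valued function $w:(0,1]\to\mathbb{R}$ which is of class $C^2$ on every compact interval $[a,b]\subseteq(0,1]$ (one-sided derivatives at the endpoint $r=1$), satisfies the differential equation for all $r\in(0,1]$ and satisfies the stated conditions. Under the substitution $t=r^2/2$, $u(t)=w(r)$ the problem is equivalent to $u''=\frac{u^2}{8t^2}+\frac{\lambda}{2}$ on $(0,1/2]$, $\lim_{t\to0_+}\sqrt{t}\,u'(t)=0$, $u(1/2)=0$. *)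

theory Defs
  imports Complex_Main
begin

text \<open>On an interval \<open>[a, b]\<close> the filter \<open>at r within {a..b}\<close> gives one-sided derivatives at the
  endpoints.\<close>

definition C2_on :: "real set \<Rightarrow> (real \<Rightarrow> real) \<Rightarrow> (real \<Rightarrow> real) \<Rightarrow> (real \<Rightarrow> real) \<Rightarrow> bool" where
  "C2_on S w w' w'' \<longleftrightarrow>
     (\<forall>r\<in>S. (w has_real_derivative w' r) (at r within S)) \<and>
     (\<forall>r\<in>S. (w' has_real_derivative w'' r) (at r within S)) \<and>
     continuous_on S w''"

text \<open>A function on \<open>(0, 1]\<close> is modelled by a total function on the reals; its values outside
  \<open>(0, 1]\<close> are unconstrained. The witnesses \<open>w'\<close> and \<open>w''\<close> are determined by \<open>w\<close> on \<open>(0, 1]\<close>,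
  where at 1 they are the left-hand derivatives.\<close>

definition is_solution :: "real \<Rightarrow> (real \<Rightarrow> real) \<Rightarrow> bool" where
  "is_solution lam w \<longleftrightarrow>
     (\<exists>w' w''.
        (\<forall>a b. 0 < a \<and> a < b \<and> b \<le> 1 \<longrightarrow> C2_on {a..b} w w' w'') \<and>
        (\<forall>r\<in>{0<..1}. r\<^sup>2 * w'' r - r * w' r = lam / 2 * r ^ 4 + (w r)\<^sup>2 / 2) \<and>
        (w' \<longlongrightarrow> 0) (at_right 0) \<and>
        w 1 = 0)"

definition solvable :: "real \<Rightarrow> bool" where
  "solvable lam \<longleftrightarrow> (\<exists>w. is_solution lam w)"

end

theory Submission
  imports Defs "HOL-Analysis.Analysis" "HOL-Computational_Algebra.Polynomial"
begin

text \<open>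
  Put \<open>s = r\<^sup>2\<close>. For \<open>w(r) = -8 y(s)\<close> and \<open>lam = 64 mu\<close> the equation becomes
  \<open>- y'' = mu + (y / s)\<^sup>2\<close> on \<open>(0, 1]\<close>, and the boundary conditions become \<open>y = 0\<close> at both ends.

  Upper bound. Multiply the equation by a weight \<open>phi(s) \<ge> 0\<close> with \<open>phi(0) = phi(1) = 0\<close> and
  integrate by parts. The result is an identity whose integrand is quadratic in \<open>w\<close>, with the
  positive leading coefficient coming from \<open>w\<^sup>2 / 2\<close>; minimising it pointwise removes \<open>w\<close> and leaves
  the bound \<open>lam \<le> 16 \<integral> s\<^sup>2 phi''\<^sup>2 / phi ds / \<integral> phi ds\<close>. If \<open>phi\<close> has a simple zero at 1, the integral converges only if
  \<open>phi''\<close> vanishes there too, which suggests the cubic \<open>phi = s (1 - s) (2 - s) / 2\<close>. After a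
  further elementary estimate it gives \<open>lam \<le> 288\<close> (\<open>solvable_imp_le_288\<close>). The integration is
  phrased as monotonicity of a function \<open>F - G\<close>, where \<open>F\<close> is the boundary term of the integration
  by parts and \<open>G\<close> an explicit polynomial. The boundary term at 0 has the wrong sign only if \<open>w\<close> stays
  above a positive constant near 0, which the condition \<open>w' \<longlongrightarrow> 0\<close> excludes
  (\<open>solution_not_bounded_below_near_0\<close>).

  Lower bound. A solution is built as a power series in \<open>mu\<close>. Comparing powers of \<open>mu\<close> in the
  equation for \<open>y = \<Sum>n. mu ^ Suc n * y\<^sub>n\<close> gives linear problems \<open>- y\<^sub>n'' = f\<^sub>n\<close> with zero boundary values,
  where \<open>f\<^sub>n\<close> is a sum of products of earlier \<open>y\<^sub>i / s\<close>. All \<open>y\<^sub>n\<close> and \<open>f\<^sub>n\<close> are nonnegative polynomials. The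
  function \<open>3 s (1 - sqrt s)\<close> is a supersolution for \<open>mu = 9 / 4\<close>, that is \<open>lam = 144\<close>, and by the
  comparison principle it dominates every partial sum at \<open>mu = 9 / 4\<close> (\<open>partial_sum_le_majorant\<close>).
  Hence for \<open>mu < 9 / 4\<close> the series and its first two termwise derivatives converge geometrically
  and uniformly on \<open>(0, 1]\<close>, and the sum is a solution (\<open>transformed_problem_solution\<close>).
\<close>

section \<open>Nonexistence for large parameters\<close>

lemma is_solutionE:
  assumes "is_solution lam w"
  obtains w' w'' where
    "\<And>r. 0 < r \<Longrightarrow> r < 1 \<Longrightarrow> (w has_real_derivative w' r) (at r)"
    "\<And>r. 0 < r \<Longrightarrow> r < 1 \<Longrightarrow> (w' has_real_derivative w'' r) (at r)"
    "\<And>a. 0 < a \<Longrightarrow> a < 1 \<Longrightarrow> continuous_on {a..1} w"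
    "\<And>a. 0 < a \<Longrightarrow> a < 1 \<Longrightarrow> continuous_on {a..1} w'"
    "\<And>r. 0 < r \<Longrightarrow> r \<le> 1 \<Longrightarrow> r\<^sup>2 * w'' r - r * w' r = lam / 2 * r ^ 4 + (w r)\<^sup>2 / 2"
    "(w' \<longlongrightarrow> 0) (at_right 0)" "w 1 = 0"
proof -
  obtain w' w'' where
    C2: "\<And>a. 0 < a \<Longrightarrow> a < 1 \<Longrightarrow> C2_on {a..1} w w' w''" and
    ode: "\<And>r. 0 < r \<Longrightarrow> r \<le> 1 \<Longrightarrow> r\<^sup>2 * w'' r - r * w' r = lam / 2 * r ^ 4 + (w r)\<^sup>2 / 2" and
    lim: "(w' \<longlongrightarrow> 0) (at_right 0)" and w1: "w 1 = 0"
    using assms unfolding is_solution_def by force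
  have d1: "(w has_real_derivative w' r) (at r)" and d2: "(w' has_real_derivative w'' r) (at r)"
    if "0 < r" "r < 1" for r
  proof -
    have "C2_on {r/2..1} w w' w''" using that by (intro C2) auto
    moreover have "at r within {r/2..1} = at r" using that by (intro at_within_Icc_at) auto
    ultimately show "(w has_real_derivative w' r) (at r)" "(w' has_real_derivative w'' r) (at r)"
      using that unfolding C2_on_def
      by (metis atLeastAtMost_iff field_sum_of_halves less_add_same_cancel1 half_gt_zero less_imp_le)+
  qed
  have "continuous_on {a..1} w" "continuous_on {a..1} w'" if "0 < a" "a < 1" for a
    using C2[OF that] unfolding C2_on_def
    by (auto intro!: DERIV_continuous_on)
  with d1 d2 ode lim w1 show ?thesis using that by blast
qed

text \<open>The equation says \<open>(w' / r)' = lam r / 2 + w\<^sup>2 / (2 r\<^sup>3)\<close>. If \<open>w \<ge> c > 0\<close> near 0, the right-hand side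
  is at least \<open>c\<^sup>2 / (2 r\<^sup>3)\<close>, so integration gives \<open>r w' \<le> - c\<^sup>2 / 4 + O(r\<^sup>2)\<close>, and \<open>w'\<close> cannot tend
  to 0.\<close>

lemma solution_not_bounded_below_near_0:
  assumes "0 < c" "0 < d" "d < 1" "0 \<le> lam" and sol: "is_solution lam w"
    and low: "\<And>r. 0 < r \<Longrightarrow> r < d \<Longrightarrow> c \<le> w r"
  shows False
proof -
  obtain w' w'' where
    d1: "\<And>r. 0 < r \<Longrightarrow> r < 1 \<Longrightarrow> (w has_real_derivative w' r) (at r)" and
    d2: "\<And>r. 0 < r \<Longrightarrow> r < 1 \<Longrightarrow> (w' has_real_derivative w'' r) (at r)" and
    ode: "\<And>r. 0 < r \<Longrightarrow> r \<le> 1 \<Longrightarrow> r\<^sup>2 * w'' r - r * w' r = lam / 2 * r ^ 4 + (w r)\<^sup>2 / 2" and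
    lim: "(w' \<longlongrightarrow> 0) (at_right 0)"
    by (rule is_solutionE[OF sol]) blast
  define H where "H = (\<lambda>r. w' r / r + c\<^sup>2 / (4 * r\<^sup>2))"
  define b where "b = d / 2"
  have b: "0 < b" "b < d" "b < 1" using assms by (auto simp: b_def)
  have mono: "H a \<le> H b" if a: "0 < a" "a < b" for a
  proof (rule DERIV_nonneg_imp_nondecreasing[where f = H])
    fix r assume r: "a \<le> r" "r \<le> b"
    have r0: "0 < r" "r < 1" "r < d" using r a b by auto
    have "(H has_real_derivative (w'' r * r - w' r) / (r * r) - c\<^sup>2 / (2 * r ^ 3)) (at r)"
      unfolding H_def using r0
      by (auto intro!: derivative_eq_intros d2 simp: field_simps power2_eq_square power3_eq_cube)
    moreover have "(w'' r * r - w' r) / (r * r) = (r\<^sup>2 * w'' r - r * w' r) / r ^ 3"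
      using r0 by (simp add: field_simps power2_eq_square power3_eq_cube)
    moreover have "(r\<^sup>2 * w'' r - r * w' r) / r ^ 3 \<ge> c\<^sup>2 / (2 * r ^ 3)"
    proof -
      have "c\<^sup>2 \<le> (w r)\<^sup>2" using low[of r] r0 assms by (intro power_mono) auto
      then have "c\<^sup>2 / 2 \<le> r\<^sup>2 * w'' r - r * w' r"
        using ode[of r] r0 assms(4) by (simp add: add_increasing)
      then have "c\<^sup>2 / 2 / r ^ 3 \<le> (r\<^sup>2 * w'' r - r * w' r) / r ^ 3"
        using r0 by (intro divide_right_mono) auto
      then show ?thesis by simp
    qed
    ultimately show "\<exists>y. (H has_real_derivative y) (at r) \<and> 0 \<le> y" by fastforce
  qed (use a in auto)
  \<comment> \<open>Multiplying \<open>H a \<le> H b\<close> by \<open>a\<^sup>2\<close> isolates the constant \<open>c\<^sup>2 / 4\<close> as \<open>a\<close> tends to 0.\<close>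
  have "\<forall>\<^sub>F a in at_right 0. a * w' a + c\<^sup>2 / 4 \<le> a\<^sup>2 * H b"
    using eventually_at_right_less[of "0::real"] eventually_at_right_real[OF b(1)]
  proof eventually_elim
    case (elim a)
    have "a\<^sup>2 * H a \<le> a\<^sup>2 * H b" using mono[of a] elim by (intro mult_left_mono) auto
    moreover have "a\<^sup>2 * H a = a * w' a + c\<^sup>2 / 4"
      using elim unfolding H_def by (simp add: field_simps power2_eq_square)
    ultimately show ?case by simp
  qed
  moreover have "((\<lambda>a. a * w' a + c\<^sup>2 / 4) \<longlongrightarrow> 0 * 0 + c\<^sup>2 / 4) (at_right 0)"
    by (intro tendsto_intros lim)
  moreover have "((\<lambda>a. a\<^sup>2 * H b) \<longlongrightarrow> 0\<^sup>2 * H b) (at_right 0)"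
    by (intro tendsto_intros)
  ultimately have "0 * 0 + c\<^sup>2 / 4 \<le> 0\<^sup>2 * H b"
    by (intro tendsto_le[OF trivial_limit_at_right_real])
  then show False using \<open>0 < c\<close> by simp
qed

text \<open>The pointwise minimisation over the value \<open>x\<close> of \<open>w\<close>: completing the square costs exactly
  \<open>144 s (1 - s) / (2 - s)\<close>. The factor \<open>1 / (2 - s)\<close> is convex on \<open>[0, 1]\<close> and is replaced by its
  chord \<open>(1 + s) / 2\<close>, so that the remainder has a polynomial antiderivative. The term
  \<open>12 (1 - s) x\<close> is \<open>- 4 phi'' x\<close> for the weight \<open>phi = s (1 - s) (2 - s) / 2\<close>.\<close>

lemma weighted_quadratic_bound:
  fixes s x lam :: real
  assumes s: "0 < s" "s < 1"
  shows "(lam / 2 + x\<^sup>2 / (2 * s\<^sup>2)) * (s * (1 - s) * (2 - s) / 2) + 12 * (1 - s) * x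
    \<ge> lam / 2 * (s * (1 - s) * (2 - s) / 2) - 72 * s * (1 - s\<^sup>2)"
proof -
  have "0 \<le> ((2 - s) * x + 24 * s)\<^sup>2 * (1 - s) / (4 * s * (2 - s))"
    using s by (intro divide_nonneg_pos mult_nonneg_nonneg) auto
  also have "\<dots> = x\<^sup>2 / (2 * s\<^sup>2) * (s * (1 - s) * (2 - s) / 2) + 12 * (1 - s) * x
      + 144 * s * (1 - s) / (2 - s)"
    using s by (simp add: divide_simps power2_eq_square) (simp add: algebra_simps)
  finally have 1: "0 \<le> x\<^sup>2 / (2 * s\<^sup>2) * (s * (1 - s) * (2 - s) / 2) + 12 * (1 - s) * x
      + 144 * s * (1 - s) / (2 - s)" .
  have "2 \<le> (1 + s) * (2 - s)" using s mult_nonneg_nonneg[of s "1 - s"] by (simp add: algebra_simps)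
  then have "144 * s * (1 - s) \<le> 72 * s * (1 - s) * ((1 + s) * (2 - s))"
    using mult_left_mono[of 2 "(1 + s) * (2 - s)" "72 * s * (1 - s)"] s by simp
  also have "\<dots> = 72 * s * (1 - s\<^sup>2) * (2 - s)" by (simp add: power2_eq_square algebra_simps)
  finally have "144 * s * (1 - s) / (2 - s) \<le> 72 * s * (1 - s\<^sup>2)"
    using s by (simp add: divide_le_eq)
  with 1 show ?thesis unfolding distrib_right[of "lam / 2"] by linarith
qed

text \<open>\<open>F\<close> is the boundary term \<open>(w' / r) phi - 2 w phi'\<close> with \<open>phi\<close> and its derivative \<open>phi'\<close>
  taken at \<open>s = r\<^sup>2\<close>, and \<open>G\<close> is the antiderivative, zero at 0, of the lower bound for \<open>F'\<close> from
  \<open>weighted_quadratic_bound\<close>. Since \<open>F 1 = 0\<close> and \<open>G 1 = lam / 32 - 9\<close>, a parameter above 288 makes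
  \<open>F - G\<close> at most a negative constant on all of \<open>(0, 1]\<close>; near 0 only the term \<open>2 w phi'\<close> of \<open>F\<close>
  can account for this, so \<open>w\<close> is bounded below there by a positive constant.\<close>

lemma solvable_imp_le_288:
  assumes "solvable lam"
  shows "lam \<le> 288"
proof (rule ccontr)
  assume "\<not> lam \<le> 288"
  then have lam: "lam > 288" by simp
  obtain w where sol: "is_solution lam w" using assms by (auto simp: solvable_def)
  obtain w' w'' where
    d1: "\<And>r. 0 < r \<Longrightarrow> r < 1 \<Longrightarrow> (w has_real_derivative w' r) (at r)" and
    d2: "\<And>r. 0 < r \<Longrightarrow> r < 1 \<Longrightarrow> (w' has_real_derivative w'' r) (at r)" and
    c1: "\<And>a. 0 < a \<Longrightarrow> a < 1 \<Longrightarrow> continuous_on {a..1} w" and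
    c2: "\<And>a. 0 < a \<Longrightarrow> a < 1 \<Longrightarrow> continuous_on {a..1} w'" and
    ode: "\<And>r. 0 < r \<Longrightarrow> r \<le> 1 \<Longrightarrow> r\<^sup>2 * w'' r - r * w' r = lam / 2 * r ^ 4 + (w r)\<^sup>2 / 2" and
    lim: "(w' \<longlongrightarrow> 0) (at_right 0)" and w1: "w 1 = 0"
    by (rule is_solutionE[OF sol]) blast
  define F where "F = (\<lambda>r. w' r / r * (r\<^sup>2 * (1 - r\<^sup>2) * (2 - r\<^sup>2) / 2) - w r * (2 - 6 * r\<^sup>2 + 3 * r ^ 4))"
  define G where "G = (\<lambda>r. lam / 4 * (r ^ 4 / 2 - r ^ 6 / 2 + r ^ 8 / 8) - 18 * r ^ 4 + 9 * r ^ 8)"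
  define g where "g = lam / 32 - 9"
  have g: "0 < g" using lam by (simp add: g_def)
  have mono: "F a - G a \<le> F 1 - G 1" if a: "0 < a" "a < 1" for a
  proof (rule DERIV_nonneg_imp_increasing_open[where f = "\<lambda>r. F r - G r"])
    fix r assume r: "a < r" "r < 1"
    have r0: "0 < r" "r < 1" using r a by auto
    define D where "D = (lam / 2 + (w r)\<^sup>2 / (2 * (r\<^sup>2)\<^sup>2)) * (r\<^sup>2 * (1 - r\<^sup>2) * (2 - r\<^sup>2) / 2) + 12 * (1 - r\<^sup>2) * w r"
    have w'': "w'' r = (r * w' r + lam / 2 * r ^ 4 + (w r)\<^sup>2 / 2) / r\<^sup>2"
      using ode[of r] r0 by (simp add: field_simps)
    have "((\<lambda>r. w' r / r * (r\<^sup>2 * (1 - r\<^sup>2) * (2 - r\<^sup>2) / 2) - w r * (2 - 6 * r\<^sup>2 + 3 * r ^ 4))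
       has_real_derivative
         (w'' r * r - w' r) / r\<^sup>2 * (r\<^sup>2 * (1 - r\<^sup>2) * (2 - r\<^sup>2) / 2)
         + w' r / r * (r * (2 - 6 * r\<^sup>2 + 3 * r ^ 4))
         - (w' r * (2 - 6 * r\<^sup>2 + 3 * r ^ 4) + w r * (12 * r ^ 3 - 12 * r))) (at r)"
      using r0 by (auto intro!: derivative_eq_intros d1 d2) (simp_all add: divide_simps, (simp add: algebra_simps power_numeral_reduce)?)
    moreover have "(w'' r * r - w' r) / r\<^sup>2 = r * (lam / 2 + (w r)\<^sup>2 / (2 * (r\<^sup>2)\<^sup>2))"
      unfolding w'' using r0 by (simp add: divide_simps) (simp add: algebra_simps power_numeral_reduce)
    ultimately have F': "(F has_real_derivative r * D) (at r)"
      unfolding F_def D_def using r0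
      by (elim DERIV_cong) (simp add: algebra_simps power_numeral_reduce)
    have "(G has_real_derivative r * (lam / 2 * (r\<^sup>2 * (1 - r\<^sup>2) * (2 - r\<^sup>2) / 2) - 72 * r\<^sup>2 * (1 - (r\<^sup>2)\<^sup>2))) (at r)"
      unfolding G_def
      by (auto intro!: derivative_eq_intros) (simp add: algebra_simps power_numeral_reduce)
    from DERIV_diff[OF F' this]
    have "((\<lambda>r. F r - G r) has_real_derivative
      r * (D - (lam / 2 * (r\<^sup>2 * (1 - r\<^sup>2) * (2 - r\<^sup>2) / 2) - 72 * r\<^sup>2 * (1 - (r\<^sup>2)\<^sup>2)))) (at r)"
      by (simp add: right_diff_distrib)
    moreover have "0 \<le> r * (D - (lam / 2 * (r\<^sup>2 * (1 - r\<^sup>2) * (2 - r\<^sup>2) / 2) - 72 * r\<^sup>2 * (1 - (r\<^sup>2)\<^sup>2)))"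
      using weighted_quadratic_bound[of "r\<^sup>2" lam "w r"] r0 unfolding D_def
      by (intro mult_nonneg_nonneg) (auto simp: power_less_one_iff)
    ultimately show "\<exists>y. ((\<lambda>r. F r - G r) has_real_derivative y) (at r) \<and> 0 \<le> y" by blast
  next
    show "continuous_on {a..1} (\<lambda>r. F r - G r)"
      unfolding F_def G_def using a c1[OF a] c2[OF a] by (auto intro!: continuous_intros)
  qed (use a in auto)
  have FG1: "F 1 - G 1 = - g" by (simp add: F_def G_def g_def w1)
  \<comment> \<open>The part of \<open>F - G\<close> that vanishes at 0; what remains is the term with \<open>w\<close> itself.\<close>
  define E where "E = (\<lambda>r. w' r * (r * (1 - r\<^sup>2) * (2 - r\<^sup>2) / 2) - G r)"
  have "(E \<longlongrightarrow> 0 * (0 * (1 - 0\<^sup>2) * (2 - 0\<^sup>2) / 2) - G 0) (at_right 0)"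
    unfolding E_def G_def by (intro tendsto_intros lim) simp_all
  then have "(E \<longlongrightarrow> 0) (at_right 0)" by (simp add: G_def)
  then have "\<forall>\<^sub>F r in at_right 0. - g / 2 < E r" using g by (intro order_tendstoD) auto
  then obtain d0 where d0: "0 < d0" "\<And>r. 0 < r \<Longrightarrow> r < d0 \<Longrightarrow> - g / 2 < E r"
    by (auto simp: eventually_at_right_field)
  define d where "d = min d0 (1/2)"
  have "g / 4 \<le> w r" if r: "0 < r" "r < d" for r
  proof -
    have r': "r < d0" "r < 1/2" using r by (auto simp: d_def)
    have "F r - G r = E r - w r * (2 - 6 * r\<^sup>2 + 3 * r ^ 4)"
      unfolding E_def F_def using r by (simp add: field_simps power2_eq_square)
    then have *: "g / 2 \<le> w r * (2 - 6 * r\<^sup>2 + 3 * r ^ 4)"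
      using mono[of r] d0(2)[of r] r r' FG1 by auto
    have s: "r\<^sup>2 \<le> (1/2)\<^sup>2" using r r' by (intro power_mono) auto
    have "r ^ 4 = r\<^sup>2 * r\<^sup>2" by (simp add: power_numeral_reduce)
    also have "\<dots> \<le> r\<^sup>2 * 1" using s by (intro mult_left_mono) (auto simp: power2_eq_square)
    finally have up: "2 - 6 * r\<^sup>2 + 3 * r ^ 4 \<le> 2" using zero_le_power2[of r] by linarith
    have pos: "0 < 2 - 6 * r\<^sup>2 + 3 * r ^ 4" using s r by (intro add_pos_pos) (auto simp: power2_eq_square)
    have "0 < w r" using * g pos by (smt (verit) zero_less_mult_pos2 half_gt_zero)
    then have "w r * (2 - 6 * r\<^sup>2 + 3 * r ^ 4) \<le> w r * 2" using up by (intro mult_left_mono) auto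
    with * show ?thesis by simp
  qed
  moreover have "0 < d" "d < 1" using d0(1) by (simp_all add: d_def min_less_iff_disj)
  ultimately show False
    using solution_not_bounded_below_near_0[of "g / 4" d lam w] g lam sol by simp
qed

section \<open>Existence for small parameters: the coefficient polynomials\<close>

lemma poly_antiderivative: "\<exists>P. pderiv P = (f :: real poly)"
proof
  show "pderiv (\<Sum>i\<le>degree f. monom (coeff f i / real (Suc i)) (Suc i)) = f"
    by (simp add: higher_pderiv_sum[of 1, simplified] pderiv_monom poly_as_sum_of_monoms del: of_nat_Suc)
qed

text \<open>The solution \<open>y\<close> of \<open>- y'' = f\<close> with \<open>y 0 = y 1 = 0\<close> is divisible by the variable. Working
  with the quotient \<open>p = y / s\<close> keeps the singular term \<open>(y / s)\<^sup>2\<close> of the equation polynomial.\<close>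

lemma poly_dirichlet_problem:
  "\<exists>p :: real poly. pderiv (pderiv (pCons 0 p)) = - f \<and> poly p 1 = 0"
proof -
  obtain A where A: "pderiv A = - f" using poly_antiderivative by blast
  obtain B where B: "pderiv B = A" using poly_antiderivative by blast
  define y where "y = B - [:poly B 0, poly B 1 - poly B 0:]"
  obtain a p where y: "y = pCons a p" by (cases y)
  have "poly y 0 = 0" "poly y 1 = 0" by (simp_all add: y_def)
  then have "a = 0" "poly p 1 = 0" by (auto simp: y)
  moreover have "pderiv (pderiv y) = - f" by (simp add: y_def pderiv_diff pderiv_pCons A B)
  ultimately show ?thesis using y by blast
qed

definition dirichlet_quotient :: "real poly \<Rightarrow> real poly" where
  "dirichlet_quotient f = (SOME p. pderiv (pderiv (pCons 0 p)) = - f \<and> poly p 1 = 0)"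

lemma dirichlet_quotient:
  "pderiv (pderiv (pCons 0 (dirichlet_quotient f))) = - f" "poly (dirichlet_quotient f) 1 = 0"
  using someI_ex[OF poly_dirichlet_problem[of f]] unfolding dirichlet_quotient_def by auto

text \<open>\<open>coef n\<close> is the coefficient of \<open>mu ^ Suc n\<close> in the expansion of \<open>y / s\<close>. The index is shifted
  because the expansion has no constant term; this makes the coefficients of \<open>(y / s)\<^sup>2\<close> an ordinary
  Cauchy product.\<close>

fun coef :: "nat \<Rightarrow> real poly" where
  "coef 0 = dirichlet_quotient 1"
| "coef (Suc n) = dirichlet_quotient (\<Sum>i\<le>n. coef i * coef (n - i))"

text \<open>The coefficient of \<open>mu ^ Suc n\<close> in \<open>mu + (y / s)\<^sup>2\<close>.\<close>

fun source :: "nat \<Rightarrow> real poly" where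
  "source 0 = 1"
| "source (Suc n) = (\<Sum>i\<le>n. coef i * coef (n - i))"

lemma coef_eq: "coef n = dirichlet_quotient (source n)"
  by (cases n) auto

text \<open>The coefficient functions of \<open>y\<close> and of its derivative.\<close>

definition mode :: "nat \<Rightarrow> real \<Rightarrow> real" where "mode n s = s * poly (coef n) s"

definition mode' :: "nat \<Rightarrow> real \<Rightarrow> real" where "mode' n s = poly (pderiv (pCons 0 (coef n))) s"

lemma mode_derivs:
  "(mode n has_real_derivative mode' n s) (at s within A)"
  "(mode' n has_real_derivative - poly (source n) s) (at s within A)"
proof -
  have eq: "mode n = poly (pCons 0 (coef n))" by (auto simp: mode_def)
  show "(mode n has_real_derivative mode' n s) (at s within A)"
    unfolding eq mode'_def by (intro DERIV_subset[OF poly_DERIV]) simp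
  have "poly (pderiv (pderiv (pCons 0 (coef n)))) s = - poly (source n) s"
    by (subst coef_eq) (simp add: dirichlet_quotient)
  then show "(mode' n has_real_derivative - poly (source n) s) (at s within A)"
    using DERIV_subset[OF poly_DERIV[of "pderiv (pCons 0 (coef n))" s], of A]
    by (simp add: mode'_def[abs_def])
qed

lemma mode_boundary: "mode n 0 = 0" "mode n 1 = 0"
  by (simp_all add: mode_def coef_eq[of n] dirichlet_quotient)

section \<open>The comparison principle and the supersolution\<close>

text \<open>Concave functions lie above their chords. A negative value in the interior would force a
  negative slope to its left and a positive one to its right, while the slope decreases. The
  second derivative is required in the open interval only, because the supersolution
  \<open>3 s (1 - sqrt s)\<close> has none at 0.\<close>

lemma nonneg_of_second_deriv_nonpos:
  fixes h h' h'' :: "real \<Rightarrow> real"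
  assumes cont: "continuous_on {0..1} h"
    and d1: "\<And>x. 0 < x \<Longrightarrow> x < 1 \<Longrightarrow> (h has_real_derivative h' x) (at x)"
    and d2: "\<And>x. 0 < x \<Longrightarrow> x < 1 \<Longrightarrow> (h' has_real_derivative h'' x) (at x)"
    and neg: "\<And>x. 0 < x \<Longrightarrow> x < 1 \<Longrightarrow> h'' x \<le> 0"
    and bd: "h 0 = 0" "h 1 = 0" and x: "0 \<le> x" "x \<le> 1"
  shows "0 \<le> h x"
proof (rule ccontr)
  assume "\<not> 0 \<le> h x"
  then have hx: "h x < 0" by simp
  with bd x have x': "0 < x" "x < 1" by (auto simp: less_le)
  have diff: "h differentiable (at z)" if "0 < z" "z < 1" for z
    using d1[OF that] by (auto simp: real_differentiable_def)
  have "\<exists>l z. 0 < z \<and> z < x \<and> (h has_real_derivative l) (at z) \<and> h x - h 0 = (x - 0) * l"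
    by (intro MVT continuous_on_subset[OF cont] diff) (use x' in auto)
  then obtain l z where z: "0 < z" "z < x" "(h has_real_derivative l) (at z)" "h x = x * l"
    using bd by auto
  have "l = h' z" using z d1[of z] x' DERIV_unique by force
  have "\<exists>l z. x < z \<and> z < 1 \<and> (h has_real_derivative l) (at z) \<and> h 1 - h x = (1 - x) * l"
    by (intro MVT continuous_on_subset[OF cont] diff) (use x' in auto)
  then obtain m y where y: "x < y" "y < 1" "(h has_real_derivative m) (at y)" "- h x = (1 - x) * m"
    using bd by auto
  have "m = h' y" using y d1[of y] x' DERIV_unique by force
  have "h' y \<le> h' z"
    by (rule DERIV_nonpos_imp_nonincreasing[of z y h']) (use z y x' d2 neg in force)+
  moreover have "h' z < 0" using z hx x' \<open>l = h' z\<close> by (simp add: mult_less_0_iff)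
  moreover have "0 < h' y"
  proof -
    have "0 < (1 - x) * m" using y hx by simp
    then show ?thesis using x' \<open>m = h' y\<close> by (simp add: zero_less_mult_iff)
  qed
  ultimately show False by simp
qed

lemma coef_source_nonneg:
  "\<And>s. 0 < s \<Longrightarrow> s \<le> 1 \<Longrightarrow> 0 \<le> poly (coef n) s \<and> 0 \<le> poly (source n) s"
proof (induction n rule: less_induct)
  case (less n)
  have src: "0 \<le> poly (source n) s" if "0 < s" "s \<le> 1" for s
  proof (cases n)
    case (Suc m)
    then show ?thesis using less that by (auto simp: poly_sum intro!: sum_nonneg)
  qed auto
  have "0 \<le> mode n s"
    by (rule nonneg_of_second_deriv_nonpos[OF DERIV_continuous_on[OF mode_derivs(1)]
          mode_derivs(1) mode_derivs(2)])
      (use less.prems src mode_boundary in auto)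
  then show ?case using src less.prems by (auto simp: mode_def zero_le_mult_iff)
qed

lemma sum_convolution_le_square:
  fixes a :: "nat \<Rightarrow> real"
  assumes "\<And>i. 0 \<le> a i"
  shows "(\<Sum>k<n. \<Sum>i\<le>k. a i * a (k - i)) \<le> (\<Sum>i<n. a i)\<^sup>2"
proof -
  have "(\<Sum>k<n. \<Sum>i\<le>k. a i * a (k - i)) = (\<Sum>(i,j)\<in>{(i,j). i + j < n}. a i * a j)"
    by (rule sum.triangle_reindex[symmetric])
  also have "\<dots> \<le> (\<Sum>(i,j)\<in>{..<n} \<times> {..<n}. a i * a j)"
    using assms by (intro sum_mono2) auto
  also have "\<dots> = (\<Sum>i<n. a i)\<^sup>2"
    by (simp add: power2_eq_square sum_product sum.cartesian_product)
  finally show ?thesis .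
qed

lemma source_Suc_scaled:
  "(\<Sum>i\<le>k. (c ^ Suc i * poly (coef i) s) * (c ^ Suc (k - i) * poly (coef (k - i)) s))
     = c ^ Suc (Suc k) * poly (source (Suc k)) s"
proof -
  have "c ^ Suc i * poly (coef i) s * (c ^ Suc (k - i) * poly (coef (k - i)) s) =
      c ^ Suc (Suc k) * (poly (coef i) s * poly (coef (k - i)) s)" if "i \<le> k" for i
  proof -
    have "c ^ Suc i * c ^ Suc (k - i) = c ^ Suc (Suc k)"
      using that by (simp flip: power_add add: power_Suc2 mult_ac)
    then show ?thesis by (metis (no_types, lifting) mult.assoc mult.left_commute)
  qed
  then have "(\<Sum>i\<le>k. (c ^ Suc i * poly (coef i) s) * (c ^ Suc (k - i) * poly (coef (k - i)) s)) =
      (\<Sum>i\<le>k. c ^ Suc (Suc k) * (poly (coef i) s * poly (coef (k - i)) s))"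
    by (intro sum.cong refl) (simp only: atMost_iff)
  then show ?thesis by (simp only: source.simps poly_sum poly_mult sum_distrib_left)
qed

text \<open>The sources up to index \<open>n\<close> involve only products of coefficients whose indices add up to
  less than \<open>n\<close>; these all occur in the square of the \<open>n\<close>-th partial sum, whose other terms are
  nonnegative. This shift by one is what makes the induction in \<open>partial_sum_le_majorant\<close> work.\<close>

lemma partial_source_bound:
  assumes s: "0 < s" "s \<le> 1" and b: "(\<Sum>k<n. (9/4) ^ Suc k * poly (coef k) s) \<le> 3 * (1 - sqrt s)"
  shows "(\<Sum>k<Suc n. (9/4) ^ Suc k * poly (source k) s) \<le> 9/4 + 9 * (1 - sqrt s)\<^sup>2"
proof -
  define a where "a = (\<lambda>k. (9/4) ^ Suc k * poly (coef k) s)"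
  have a: "0 \<le> a i" for i using coef_source_nonneg[OF s] by (simp add: a_def)
  have "(\<Sum>k<Suc n. (9/4) ^ Suc k * poly (source k) s) = 9/4 + (\<Sum>k<n. \<Sum>i\<le>k. a i * a (k - i))"
    unfolding a_def source_Suc_scaled by (subst sum.lessThan_Suc_shift) simp
  also have "\<dots> \<le> 9/4 + (\<Sum>i<n. a i)\<^sup>2" using sum_convolution_le_square[of a n] a by simp
  also have "(\<Sum>i<n. a i)\<^sup>2 \<le> (3 * (1 - sqrt s))\<^sup>2"
    using b a by (intro power_mono sum_nonneg) (auto simp: a_def)
  finally show ?thesis by (simp only: power_mult_distrib) simp
qed

text \<open>The function \<open>V = 3 s (1 - sqrt s)\<close> has \<open>- V'' = 9 / (4 sqrt s)\<close>, so this is the inequality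
  \<open>- V'' \<ge> 9 / 4 + (V / s)\<^sup>2\<close> of a supersolution. With \<open>z = sqrt s\<close> it reduces to
  \<open>4 z (1 - z) \<le> 1\<close>, with equality at \<open>z = 1 / 2\<close>.\<close>

lemma majorant_inequality:
  assumes s: "0 < s" "s \<le> (1::real)"
  shows "9/4 + 9 * (1 - sqrt s)\<^sup>2 \<le> 9 / (4 * sqrt s)"
proof -
  define z where "z = sqrt s"
  have z: "0 < z" "z \<le> 1" using s by (auto simp: z_def)
  have "0 \<le> (1 - z) * (2 * z - 1)\<^sup>2" using z by auto
  then have "(9/4 + 9 * (1 - z)\<^sup>2) * (4 * z) \<le> 9"
    by (simp add: power2_eq_square algebra_simps)
  then show ?thesis using z unfolding z_def[symmetric] by (simp add: le_divide_eq)
qed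

text \<open>Induction on the number of terms: if the bound holds for \<open>n\<close> terms, the sources of the next
  partial sum are dominated by \<open>- V''\<close>, so \<open>V\<close> minus that partial sum (times \<open>s\<close>) is concave with
  zero boundary values, hence nonnegative.\<close>

lemma partial_sum_le_majorant:
  "\<And>s. 0 < s \<Longrightarrow> s \<le> 1 \<Longrightarrow> (\<Sum>k<n. (9/4) ^ Suc k * poly (coef k) s) \<le> 3 * (1 - sqrt s)"
proof (induction n)
  case (Suc n)
  define h where "h = (\<lambda>s. 3 * s - 3 * (s * sqrt s) - (\<Sum>k<Suc n. (9/4) ^ Suc k * mode k s))"
  define h' where "h' = (\<lambda>s. 3 - 9/2 * sqrt s - (\<Sum>k<Suc n. (9/4) ^ Suc k * mode' k s))"
  define h'' where "h'' = (\<lambda>s. - 9 / (4 * sqrt s) - (\<Sum>k<Suc n. (9/4) ^ Suc k * - poly (source k) s))"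
  have "0 \<le> h s"
  proof (rule nonneg_of_second_deriv_nonpos[where h = h and h' = h' and h'' = h''])
    have "continuous_on {0..1} (mode k)" for k
      using mode_derivs(1) by (rule DERIV_continuous_on)
    then show "continuous_on {0..1} h" unfolding h_def by (intro continuous_intros) auto
    fix x :: real assume x: "0 < x" "x < 1"
    have "((\<lambda>s. 3 * s - 3 * (s * sqrt s)) has_real_derivative 3 - 9/2 * sqrt x) (at x)"
      using x by (auto intro!: derivative_eq_intros simp: field_simps)
    then show "(h has_real_derivative h' x) (at x)"
      unfolding h_def h'_def
      by (rule DERIV_diff) (intro DERIV_sum DERIV_cmult mode_derivs)
    have "((\<lambda>s. 3 - 9/2 * sqrt s) has_real_derivative - 9 / (4 * sqrt x)) (at x)"
      using x by (auto intro!: derivative_eq_intros simp: field_simps)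
    then show "(h' has_real_derivative h'' x) (at x)"
      unfolding h'_def h''_def
      by (rule DERIV_diff) (intro DERIV_sum DERIV_cmult mode_derivs)
    show "h'' x \<le> 0"
      using partial_source_bound[of x n] Suc.IH[of x] majorant_inequality[of x] x
      by (simp add: h''_def sum_negf del: power_Suc sum.lessThan_Suc)
  qed (use Suc.prems mode_boundary in \<open>auto simp: h_def simp del: power_Suc sum.lessThan_Suc\<close>)
  moreover have "h s = s * (3 * (1 - sqrt s) - (\<Sum>k<Suc n. (9/4) ^ Suc k * poly (coef k) s))"
    unfolding h_def mode_def
    by (simp add: right_diff_distrib sum_distrib_left mult_ac del: power_Suc sum.lessThan_Suc)
  ultimately show ?case using Suc.prems by (auto simp: zero_le_mult_iff)
qed auto

section \<open>Summation of the series\<close>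

lemma coef_bound:
  assumes s: "0 < s" "s \<le> 1"
  shows "(9/4) ^ Suc n * poly (coef n) s \<le> 3"
proof -
  have "(9/4) ^ Suc n * poly (coef n) s \<le> (\<Sum>k<Suc n. (9/4) ^ Suc k * poly (coef k) s)"
    using coef_source_nonneg[OF s] by (intro member_le_sum) auto
  also have "\<dots> \<le> 3 * (1 - sqrt s)" using s by (rule partial_sum_le_majorant)
  also have "\<dots> \<le> 3" using s by simp
  finally show ?thesis .
qed

lemma source_bound:
  assumes s: "0 < s" "s \<le> 1"
  shows "(9/4) ^ Suc n * poly (source n) s \<le> 12"
proof -
  have "(9/4) ^ Suc n * poly (source n) s \<le> (\<Sum>k<Suc n. (9/4) ^ Suc k * poly (source k) s)"
    using coef_source_nonneg[OF s] by (intro member_le_sum) auto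
  also have "\<dots> \<le> 9/4 + 9 * (1 - sqrt s)\<^sup>2"
    using s by (intro partial_source_bound partial_sum_le_majorant)
  also have "(1 - sqrt s)\<^sup>2 \<le> 1" using s by (intro power_le_one) auto
  finally show ?thesis by simp
qed

text \<open>As \<open>mode n\<close> vanishes at both ends, its derivative has a zero, and from there the bound on
  the second derivative \<open>- source n\<close> propagates over an interval of length at most 1.\<close>

lemma mode'_bound:
  assumes s: "0 < s" "s \<le> 1"
  shows "(9/4) ^ Suc n * \<bar>mode' n s\<bar> \<le> 12"
proof -
  have "\<exists>l z. 0 < z \<and> z < 1 \<and> (mode n has_real_derivative l) (at z) \<and> mode n 1 - mode n 0 = (1 - 0) * l"
    by (intro MVT DERIV_continuous_on[OF mode_derivs(1)])
      (auto simp: real_differentiable_def intro: mode_derivs)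
  then obtain z where z: "0 < z" "z < 1" "mode' n z = 0"
    using mode_boundary DERIV_unique mode_derivs(1) by fastforce
  have "norm (mode' n s - mode' n z) \<le> 12 / (9/4) ^ Suc n * norm (s - z)"
  proof (rule field_differentiable_bound[where S = "{0<..1}"])
    fix x :: real assume x: "x \<in> {0<..1}"
    show "(mode' n has_field_derivative - poly (source n) x) (at x within {0<..1})"
      by (rule mode_derivs)
    show "norm (- poly (source n) x) \<le> 12 / (9/4) ^ Suc n"
      using source_bound[of x n] coef_source_nonneg[of x n] x by (simp add: field_simps)
  qed (use s z in auto)
  also have "\<dots> \<le> 12 / (9/4) ^ Suc n * 1"
    using s z by (intro mult_left_mono) auto
  finally show ?thesis using z by (simp add: field_simps)
qed

lemma geometric_scaled_bound:
  fixes mu x C :: real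
  assumes "0 < mu" "(9/4) ^ Suc n * \<bar>x\<bar> \<le> C"
  shows "norm (mu ^ Suc n * x) \<le> C * (mu / (9/4)) ^ Suc n"
proof -
  have "norm (mu ^ Suc n * x) = (mu / (9/4)) ^ Suc n * ((9/4) ^ Suc n * \<bar>x\<bar>)"
    using assms(1) by (simp add: abs_mult power_divide del: power_Suc)
  also have "\<dots> \<le> (mu / (9/4)) ^ Suc n * C" using assms by (intro mult_left_mono) auto
  finally show ?thesis by (simp add: mult.commute)
qed

text \<open>The bounds at \<open>mu = 9 / 4\<close> turn into geometric majorants with ratio \<open>mu / (9 / 4) < 1\<close>, so the
  series may be differentiated twice term by term, and the Cauchy product identifies the second
  derivative. A bound on \<open>y'\<close> up to the singular point 0 is part of the conclusion because
  \<open>w' r = - 16 r y' (r\<^sup>2)\<close> has to tend to 0.\<close>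

lemma transformed_problem_solution:
  assumes mu: "0 < mu" "mu < 9/4"
  obtains y y' C where
    "\<And>s. 0 < s \<Longrightarrow> s \<le> 1 \<Longrightarrow> (y has_real_derivative y' s) (at s within {0<..1})"
    "\<And>s. 0 < s \<Longrightarrow> s \<le> 1 \<Longrightarrow> (y' has_real_derivative - (mu + (y s / s)\<^sup>2)) (at s within {0<..1})"
    "\<And>s. 0 < s \<Longrightarrow> s \<le> 1 \<Longrightarrow> \<bar>y' s\<bar> \<le> C" "y 1 = 0"
proof -
  define q where "q = mu / (9/4)"
  have q: "0 < q" "q < 1" using mu by (auto simp: q_def)
  have geo: "summable (\<lambda>n. C * q ^ Suc n)" for C
    using q by (intro summable_mult) (simp del: power_Suc add: summable_Suc_iff)
  define S where "S = {0<..(1::real)}"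
  have b0: "norm (mu ^ Suc n * poly (coef n) s) \<le> 3 * q ^ Suc n" if "s \<in> S" for n s
    unfolding q_def by (rule geometric_scaled_bound)
      (use that mu coef_bound[of s n] coef_source_nonneg[of s n] in \<open>auto simp: S_def\<close>)
  have b1: "norm (mu ^ Suc n * mode' n s) \<le> 12 * q ^ Suc n" if "s \<in> S" for n s
    unfolding q_def by (rule geometric_scaled_bound)
      (use that mu mode'_bound[of s n] in \<open>auto simp: S_def\<close>)
  have b2: "norm (mu ^ Suc n * - poly (source n) s) \<le> 12 * q ^ Suc n" if "s \<in> S" for n s
    unfolding q_def by (rule geometric_scaled_bound)
      (use that mu source_bound[of s n] coef_source_nonneg[of s n] in \<open>auto simp: S_def\<close>)
  define p where "p = (\<lambda>s. \<Sum>n. mu ^ Suc n * poly (coef n) s)"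
  define y where "y = (\<lambda>s. \<Sum>n. mu ^ Suc n * mode n s)"
  define y' where "y' = (\<lambda>s. \<Sum>n. mu ^ Suc n * mode' n s)"
  define y'' where "y'' = (\<lambda>s. \<Sum>n. mu ^ Suc n * - poly (source n) s)"
  have u1: "uniform_limit S (\<lambda>n s. \<Sum>i<n. mu ^ Suc i * mode' i s) y' sequentially"
    unfolding y'_def by (rule Weierstrass_m_test[OF b1 geo])
  have u2: "uniform_limit S (\<lambda>n s. \<Sum>i<n. mu ^ Suc i * - poly (source i) s) y'' sequentially"
    unfolding y''_def by (rule Weierstrass_m_test[OF b2 geo])
  have sum_p: "summable (\<lambda>n. norm (mu ^ Suc n * poly (coef n) s))" if "s \<in> S" for s
    by (rule summable_comparison_test'[OF geo[of 3], of 0]) (use b0[OF that] in simp)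
  have sum_y': "summable (\<lambda>n. mu ^ Suc n * mode' n s)" if "s \<in> S" for s
    by (rule summable_comparison_test'[OF geo[of 12], of 0]) (rule b1[OF that])
  have S: "convex S" "1 \<in> S" by (auto simp: S_def)
  have y_eq: "y s = s * p s" if "s \<in> S" for s
    using suminf_mult[OF summable_norm_cancel[OF sum_p[OF that]], of s]
    by (simp add: y_def p_def mode_def mult_ac)
  have D1: "(y has_real_derivative y' s) (at s within S)" if "s \<in> S" for s
  proof -
    have "\<exists>g. \<forall>x\<in>S. (\<lambda>n. mu ^ Suc n * mode n x) sums g x \<and> (g has_field_derivative y' x) (at x within S)"
      using S by (intro has_field_derivative_series[OF _ _ u1, of "\<lambda>n x. mu ^ Suc n * mode n x" 1]
        DERIV_cmult mode_derivs) (auto simp: mode_boundary)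
    then obtain g where g: "\<And>x. x \<in> S \<Longrightarrow> (\<lambda>n. mu ^ Suc n * mode n x) sums g x"
      "\<And>x. x \<in> S \<Longrightarrow> (g has_field_derivative y' x) (at x within S)" by blast
    then have "y x = g x" if "x \<in> S" for x using that by (simp add: y_def sums_iff)
    then show ?thesis using has_field_derivative_transform_within[OF g(2)[OF that] zero_less_one that] by simp
  qed
  have D2: "(y' has_real_derivative y'' s) (at s within S)" if "s \<in> S" for s
  proof -
    have "\<exists>g. \<forall>x\<in>S. (\<lambda>n. mu ^ Suc n * mode' n x) sums g x \<and> (g has_field_derivative y'' x) (at x within S)"
      using S by (intro has_field_derivative_series[OF _ _ u2, of "\<lambda>n x. mu ^ Suc n * mode' n x" 1]
        DERIV_cmult mode_derivs sum_y') auto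
    then obtain g where g: "\<And>x. x \<in> S \<Longrightarrow> (\<lambda>n. mu ^ Suc n * mode' n x) sums g x"
      "\<And>x. x \<in> S \<Longrightarrow> (g has_field_derivative y'' x) (at x within S)" by blast
    then have "y' x = g x" if "x \<in> S" for x using that by (simp add: y'_def sums_iff)
    then show ?thesis using has_field_derivative_transform_within[OF g(2)[OF that] zero_less_one that] by simp
  qed
  have y''_eq: "y'' s = - (mu + (y s / s)\<^sup>2)" if s: "s \<in> S" for s
  proof -
    have "(\<lambda>k. \<Sum>i\<le>k. (mu ^ Suc i * poly (coef i) s) * (mu ^ Suc (k - i) * poly (coef (k - i)) s))
        sums (p s * p s)"
      unfolding p_def by (rule Cauchy_product_sums[OF sum_p[OF s] sum_p[OF s]])
    then have "(\<lambda>k. mu ^ Suc (Suc k) * poly (source (Suc k)) s) sums (p s)\<^sup>2"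
      unfolding source_Suc_scaled by (simp add: power2_eq_square)
    then have "(\<lambda>k. mu ^ Suc k * poly (source k) s) sums ((p s)\<^sup>2 + mu ^ Suc 0 * poly (source 0) s)"
      by (subst (asm) sums_Suc_iff)
    from sums_minus[OF this] have "y'' s = - (mu + (p s)\<^sup>2)"
      by (simp add: y''_def sums_iff)
    then show ?thesis using y_eq[OF s] s by (simp add: S_def)
  qed
  have bound: "\<bar>y' s\<bar> \<le> (\<Sum>n. 12 * q ^ Suc n)" if "s \<in> S" for s
    using norm_suminf_le[OF b1[OF that] geo] by (simp add: y'_def)
  have "y 1 = 0" by (simp add: y_def mode_boundary)
  with D1 D2 y''_eq bound show ?thesis
    by (intro that[of y y' "\<Sum>n. 12 * q ^ Suc n"]) (auto simp: S_def simp del: power_Suc)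
qed

lemma solvable_below_144:
  assumes "0 < lam" "lam < 144"
  shows "solvable lam"
proof -
  obtain y y' C where
    D1: "\<And>s. 0 < s \<Longrightarrow> s \<le> 1 \<Longrightarrow> (y has_real_derivative y' s) (at s within {0<..1})" and
    D2: "\<And>s. 0 < s \<Longrightarrow> s \<le> 1 \<Longrightarrow>
      (y' has_real_derivative - (lam / 64 + (y s / s)\<^sup>2)) (at s within {0<..1})" and
    bound: "\<And>s. 0 < s \<Longrightarrow> s \<le> 1 \<Longrightarrow> \<bar>y' s\<bar> \<le> C" and y1: "y 1 = 0"
    using transformed_problem_solution[of "lam / 64"] assms by auto
  define w where "w = (\<lambda>r. - 8 * y (r\<^sup>2))"
  define w' where "w' = (\<lambda>r. - 16 * (r * y' (r\<^sup>2)))"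
  define w'' where "w'' = (\<lambda>r. - 16 * y' (r\<^sup>2) + 32 * r\<^sup>2 * (lam / 64 + (y (r\<^sup>2) / r\<^sup>2)\<^sup>2))"
  have C2: "C2_on {a..b} w w' w''" if ab: "0 < a" "a < b" "b \<le> 1" for a b
  proof -
    have sq: "0 < r\<^sup>2" "r\<^sup>2 \<le> 1" if "r \<in> {a..b}" for r
      using that ab by (auto intro!: power_le_one)
    have chain: "((\<lambda>r. f (r\<^sup>2)) has_real_derivative f' * (2 * r)) (at r within {a..b})"
      if "r \<in> {a..b}" "(f has_real_derivative f') (at (r\<^sup>2) within {0<..1})" for f f' r
    proof -
      have "(f has_real_derivative f') (at (r\<^sup>2) within (\<lambda>r. r\<^sup>2) ` {a..b})"
        using sq by (intro DERIV_subset[OF that(2)]) auto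
      moreover have "((\<lambda>r. r\<^sup>2) has_real_derivative 2 * r) (at r within {a..b})"
        by (auto intro!: derivative_eq_intros)
      ultimately show ?thesis
        using DERIV_image_chain[of f f' "\<lambda>r. r\<^sup>2" r "{a..b}" "2 * r"] by (simp add: o_def)
    qed
    have d1: "(w has_real_derivative w' r) (at r within {a..b})" if "r \<in> {a..b}" for r
      unfolding w_def w'_def
      using DERIV_cmult[OF chain[OF that D1[OF sq[OF that]]], of "- 8"] by (simp add: mult_ac)
    have dy': "((\<lambda>r. y' (r\<^sup>2)) has_real_derivative
        - (lam / 64 + (y (r\<^sup>2) / r\<^sup>2)\<^sup>2) * (2 * r)) (at r within {a..b})" if "r \<in> {a..b}" for r
      by (rule chain[OF that D2[OF sq[OF that]]])
    have d2: "(w' has_real_derivative w'' r) (at r within {a..b})" if "r \<in> {a..b}" for r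
      unfolding w'_def w''_def
      by (rule DERIV_cong[OF DERIV_cmult[OF DERIV_mult[OF DERIV_ident dy'[OF that]]]])
        (simp add: algebra_simps power2_eq_square)
    have "continuous_on {a..b} (\<lambda>r. y (r\<^sup>2))"
      using chain[OF _ D1[OF sq]] by (rule DERIV_continuous_on)
    moreover have "continuous_on {a..b} (\<lambda>r. y' (r\<^sup>2))"
      using dy' by (rule DERIV_continuous_on)
    ultimately have "continuous_on {a..b} w''"
      unfolding w''_def using ab by (intro continuous_intros) auto
    with d1 d2 show ?thesis unfolding C2_on_def by blast
  qed
  have ode: "r\<^sup>2 * w'' r - r * w' r = lam / 2 * r ^ 4 + (w r)\<^sup>2 / 2" if "r \<in> {0<..1}" for r
    using that unfolding w_def w'_def w''_def
    by (simp add: divide_simps) (simp add: algebra_simps power_numeral_reduce)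
  have lim: "(w' \<longlongrightarrow> 0) (at_right 0)"
  proof (rule Lim_null_comparison)
    have "\<forall>\<^sub>F r in at_right (0::real). r \<in> {0<..<1}" by (rule eventually_at_right_real) simp
    then show "\<forall>\<^sub>F r in at_right 0. norm (w' r) \<le> 16 * C * r"
    proof eventually_elim
      case (elim r)
      then have "\<bar>y' (r\<^sup>2)\<bar> \<le> C" by (intro bound) (auto intro!: power_le_one)
      then have "16 * r * \<bar>y' (r\<^sup>2)\<bar> \<le> 16 * r * C" using elim by (intro mult_left_mono) auto
      then show ?case using elim by (simp add: w'_def abs_mult mult_ac)
    qed
    have "((\<lambda>r. 16 * C * r) \<longlongrightarrow> 16 * C * 0) (at_right 0)" by (intro tendsto_intros)
    then show "((\<lambda>r. 16 * C * r) \<longlongrightarrow> 0) (at_right 0)" by simp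
  qed
  have "is_solution lam w"
    unfolding is_solution_def
    by (rule exI[of _ w'], rule exI[of _ w'']) (use C2 ode lim y1 in \<open>auto simp: w_def\<close>)
  then show ?thesis by (auto simp: solvable_def)
qed

theorem proposition4p1:
  fixes lam0 :: real
  assumes "lam0 > 0"
    and "\<And>lam. 0 \<le> lam \<Longrightarrow> lam < lam0 \<Longrightarrow> solvable lam"
    and "\<And>lam. lam > lam0 \<Longrightarrow> \<not> solvable lam"
  shows "144 \<le> lam0 \<and> lam0 \<le> 307"
proof
  show "144 \<le> lam0"
  proof (rule ccontr)
    assume "\<not> 144 \<le> lam0"
    then have "solvable ((lam0 + 144) / 2)" using assms(1) by (intro solvable_below_144) auto
    then show False using assms(3)[of "(lam0 + 144) / 2"] \<open>\<not> 144 \<le> lam0\<close> by simp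
  qed
  show "lam0 \<le> 307"
  proof (rule ccontr)
    assume "\<not> lam0 \<le> 307"
    then have "solvable 300" by (intro assms(2)) auto
    then show False using solvable_imp_le_288 by fastforce
  qed
qed

end
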